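(* Let $R$ be an integral domain and $(G,\alpha)$ a connected edge-labeled graph on $n$ vertices. Then $R_G$ contains a free $R$-submodule of rank $n$.
   Context: All graphs are finite, with no multiple edges, and edges join distinct vertices. An edge-labeling function on a graph $G=(V,E)$ is a map $\alpha$ from $E$ to the nonzero ideals of the commutative ring $R$. The generalized splines are $R_G=\{\mathbf{p}\in\bigoplus_{v\in V}R : \mathbf{p}_u-\mathbf{p}_v\in\alpha(uv)\text{ for every edge }uv\in E\}$, an $R$-module by componentwise scaling. *)

theory Defs
  imports
    "HOL-Library.Function_Algebras"
    "Graph_Theory.Graph_Theory"
begin

text \<open>
  A finite graph without multiple edges and loops is a \<^locale>\<open>pair_graph\<close>: every undirected
  edge \<open>uv\<close> is represented by the two arcs \<open>(u, v)\<close> and \<open>(v, u)\<close>. To keep edge labels independent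
  of the orientation, labels are attached to the unordered pairs \<open>{u, v}\<close>.
\<close>

definition edges :: "'v pair_pre_digraph \<Rightarrow> 'v set set" where
  "edges G = {{u, v} |u v. (u, v) \<in> parcs G}"

text \<open>Ideals of a commutative ring are the submodules of the ring over itself.\<close>

definition is_ideal :: "'r::comm_ring_1 set \<Rightarrow> bool" where
  "is_ideal I \<longleftrightarrow> module.subspace (*) I"

text \<open>Values of \<open>\<alpha>\<close> outside \<open>edges G\<close> are irrelevant.\<close>

definition edge_labeling :: "'v pair_pre_digraph \<Rightarrow> ('v set \<Rightarrow> 'r::comm_ring_1 set) \<Rightarrow> bool" where
  "edge_labeling G \<alpha> \<longleftrightarrow> (\<forall>e\<in>edges G. is_ideal (\<alpha> e) \<and> \<alpha> e \<noteq> {0})"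

text \<open>
  The direct sum of copies of \<open>R\<close> indexed by the finite vertex set is realised as the functions
  that vanish outside that set.
\<close>

definition splines ::
  "'v pair_pre_digraph \<Rightarrow> ('v set \<Rightarrow> 'r::comm_ring_1 set) \<Rightarrow> ('v \<Rightarrow> 'r) set" where
  "splines G \<alpha> = {p. (\<forall>v. v \<notin> pverts G \<longrightarrow> p v = 0) \<and>
     (\<forall>u v. {u, v} \<in> edges G \<longrightarrow> p u - p v \<in> \<alpha> {u, v})}"

definition scale_fun :: "'r::comm_ring_1 \<Rightarrow> ('v \<Rightarrow> 'r) \<Rightarrow> 'v \<Rightarrow> 'r" where
  "scale_fun c p = (\<lambda>v. c * p v)"

lemma module_mult: "module ((*) :: 'r::comm_ring_1 \<Rightarrow> 'r \<Rightarrow> 'r)"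
  by unfold_locales (simp_all add: algebra_simps)

interpretation fun_module: module "scale_fun :: 'r::comm_ring_1 \<Rightarrow> ('v \<Rightarrow> 'r) \<Rightarrow> 'v \<Rightarrow> 'r"
  by unfold_locales (simp_all add: scale_fun_def fun_eq_iff algebra_simps)

lemma subspace_splines:
  assumes "edge_labeling G \<alpha>"
  shows "fun_module.subspace (splines G \<alpha>)"
proof -
  have I: "module.subspace (*) (\<alpha> {u, v})" if "{u, v} \<in> edges G" for u v
    using assms that unfolding edge_labeling_def is_ideal_def by blast
  show ?thesis
  proof (rule fun_module.subspaceI)
    show "0 \<in> splines G \<alpha>"
      unfolding splines_def using module.subspace_0[OF module_mult I] by simp
  next
    fix p q assume pq: "p \<in> splines G \<alpha>" "q \<in> splines G \<alpha>"
    have "(p + q) u - (p + q) v \<in> \<alpha> {u, v}" if e: "{u, v} \<in> edges G" for u v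
    proof -
      have "(p u - p v) + (q u - q v) \<in> \<alpha> {u, v}"
        using module.subspace_add[OF module_mult I[OF e]] pq e unfolding splines_def by blast
      then show ?thesis by (simp add: add_diff_add)
    qed
    then show "p + q \<in> splines G \<alpha>"
      using pq by (simp add: splines_def)
  next
    fix c p assume p: "p \<in> splines G \<alpha>"
    have "scale_fun c p u - scale_fun c p v \<in> \<alpha> {u, v}" if e: "{u, v} \<in> edges G" for u v
    proof -
      have "c * (p u - p v) \<in> \<alpha> {u, v}"
        using module.subspace_scale[OF module_mult I[OF e]] p e unfolding splines_def by blast
      then show ?thesis by (simp add: scale_fun_def right_diff_distrib)
    qed
    then show "scale_fun c p \<in> splines G \<alpha>"
      using p by (simp add: splines_def scale_fun_def)
  qed
qed

definition free_of_rank :: "nat \<Rightarrow> ('v \<Rightarrow> 'r::comm_ring_1) set \<Rightarrow> bool" where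
  "free_of_rank n M \<longleftrightarrow>
     (\<exists>B. finite B \<and> card B = n \<and> fun_module.independent B \<and> fun_module.span B = M)"

end

theory Submission
  imports Defs
begin

text \<open>
  The finitely many edge ideals of a domain have a common nonzero element \<open>c\<close>, namely a product of
  nonzero elements of each. The vectors supported at a single vertex with value \<open>c\<close> are then
  splines, and they are linearly independent.
\<close>

lemma is_ideal_mult:
  assumes "is_ideal I" and "a \<in> I"
  shows "b * a \<in> I"
  using assms module.subspace_scale[OF module_mult] unfolding is_ideal_def by blast

lemma finite_ideals_common_nonzero:
  fixes I :: "'e \<Rightarrow> 'r::idom set"
  assumes "finite E" and "\<And>e. e \<in> E \<Longrightarrow> is_ideal (I e) \<and> I e \<noteq> {0}"
  obtains c where "c \<noteq> 0" and "\<And>e. e \<in> E \<Longrightarrow> c \<in> I e"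
proof -
  have "\<exists>a. a \<noteq> 0 \<and> a \<in> I e" if "e \<in> E" for e
  proof -
    \<comment> \<open>\<open>I e \<noteq> {0}\<close> alone would also admit the empty set; with 0
      in \<open>I e\<close> it yields a nonzero element.\<close>
    have "0 \<in> I e"
      using assms(2)[OF that] module.subspace_0[OF module_mult] unfolding is_ideal_def by blast
    then show ?thesis using assms(2)[OF that] by blast
  qed
  then obtain a where a: "\<And>e. e \<in> E \<Longrightarrow> a e \<noteq> 0 \<and> a e \<in> I e" by metis
  \<comment> \<open>A domain has no zero divisors; for empty \<open>E\<close> the product is
    1.\<close>
  have "prod a E \<noteq> 0" using a assms(1) by simp
  moreover have "prod a E \<in> I e" if "e \<in> E" for e
    using is_ideal_mult[of "I e" "a e" "prod a (E - {e})"] assms(2)[OF that] a[OF that]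
      prod.remove[OF assms(1) that, of a] by (simp add: mult.commute)
  ultimately show thesis using that by blast
qed

lemma finite_edges:
  assumes "finite (parcs G)"
  shows "finite (edges G)"
proof -
  have "edges G = (\<lambda>(u, v). {u, v}) ` parcs G" unfolding edges_def by auto
  then show ?thesis using assms by simp
qed

definition single :: "'r::comm_ring_1 \<Rightarrow> 'v \<Rightarrow> 'v \<Rightarrow> 'r" where
  "single c w = (\<lambda>v. if v = w then c else 0)"

lemma inj_single: "c \<noteq> 0 \<Longrightarrow> inj (single c)"
  by (rule injI) (auto simp: single_def fun_eq_iff split: if_splits)

lemma sum_fun_apply: "(\<Sum>i\<in>A. f i) x = (\<Sum>i\<in>A. f i x)"
  for f :: "'i \<Rightarrow> 'v \<Rightarrow> 'r::comm_monoid_add"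
  by (induction A rule: infinite_finite_induct) auto

text \<open>Distinct vectors of the family have disjoint supports, so evaluating a linear relation
  at \<open>w\<close> isolates one coefficient, multiplied by \<open>c\<close>; in a domain
  \<open>c\<close> cancels.\<close>

lemma independent_single:
  fixes c :: "'r::idom"
  assumes "c \<noteq> 0"
  shows "fun_module.independent (single c ` (V :: 'v set))"
proof
  assume "fun_module.dependent (single c ` V)"
  then obtain t a p where t: "finite t" "t \<subseteq> single c ` V" "(\<Sum>q\<in>t. scale_fun (a q) q) = 0"
    and p: "p \<in> t" "a p \<noteq> 0"
    unfolding fun_module.dependent_explicit by blast
  obtain w where w: "p = single c w" using t(2) p(1) by blast
  have "scale_fun (a q) q w = 0" if q: "q \<in> t - {p}" for q
  proof -
    \<comment> \<open>Since \<open>q\<close> differs from \<open>p\<close>, \<open>w'\<close>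
      differs from \<open>w\<close>, so \<open>q\<close> vanishes at \<open>w\<close>.\<close>
    obtain w' where "q = single c w'" using q t(2) by blast
    then show ?thesis using q w by (auto simp: scale_fun_def single_def)
  qed
  then have "(\<Sum>q\<in>t. scale_fun (a q) q w) = scale_fun (a p) p w"
    using sum.remove[OF t(1) p(1), of "\<lambda>q. scale_fun (a q) q w"] by simp
  then have "a p * c = 0"
    using fun_cong[OF t(3), of w] w by (simp add: sum_fun_apply scale_fun_def single_def)
  then show False using p(2) assms by simp
qed

lemma single_in_splines:
  assumes "edge_labeling G \<alpha>" and "w \<in> pverts G" and "\<And>e. e \<in> edges G \<Longrightarrow> c \<in> \<alpha> e"
  shows "single c w \<in> splines G \<alpha>"
proof -
  have "single c w u - single c w v \<in> \<alpha> {u, v}" if e: "{u, v} \<in> edges G" for u v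
  proof -
    \<comment> \<open>The difference across an edge is 0, \<open>c\<close> or \<open>-c\<close>;
      factoring out \<open>c\<close> makes it a ring multiple of an element of the ideal and so
      treats all three cases at once.\<close>
    have "(single 1 w u - single 1 w v) * c \<in> \<alpha> {u, v}"
      using is_ideal_mult assms(1,3) e unfolding edge_labeling_def by blast
    then show ?thesis by (simp add: single_def split: if_splits)
  qed
  then show ?thesis using assms(2) by (auto simp: splines_def single_def)
qed

theorem corollary5p2:
  fixes G :: "'v pair_pre_digraph"
    and \<alpha> :: "'v set \<Rightarrow> 'r::idom set"
    and n :: nat
  assumes "pair_graph G"
    and "connected (with_proj G)"
    and "card (pverts G) = n"
    and "edge_labeling G \<alpha>"
  shows "\<exists>M. fun_module.subspace M \<and> M \<subseteq> splines G \<alpha> \<and> free_of_rank n M"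
proof -
  interpret pair_graph G by fact
  have "finite (edges G)" by (simp add: finite_edges)
  then obtain c where c: "c \<noteq> 0" "\<And>e. e \<in> edges G \<Longrightarrow> c \<in> \<alpha> e"
    using finite_ideals_common_nonzero[of "edges G" \<alpha>] assms(4)
    unfolding edge_labeling_def by blast
  define B where "B = single c ` pverts G"
  have "B \<subseteq> splines G \<alpha>"
    using single_in_splines[OF assms(4) _ c(2)] unfolding B_def by blast
  then have "fun_module.span B \<subseteq> splines G \<alpha>"
    by (rule fun_module.span_minimal[OF _ subspace_splines[OF assms(4)]])
  \<comment> \<open>As \<open>c\<close> is nonzero, different vertices give different vectors, so no
    element is lost in passing from the vertices to the set \<open>B\<close>.\<close>
  moreover have "card B = n"
    unfolding B_def assms(3)[symmetric]
    by (rule card_image[OF inj_on_subset[OF inj_single[OF c(1)] subset_UNIV]])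
  then have "free_of_rank n (fun_module.span B)"
    unfolding free_of_rank_def
    by (intro exI[of _ B] conjI)
      (simp_all add: B_def independent_single[OF c(1)])
  ultimately show ?thesis by (intro exI[of _ "fun_module.span B"]) simp
qed

end
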